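(* Let $d\in\mathcal{D}_\Box$ and $\delta_L,\delta_R\in\mathcal{D}_\Box^*$. Then $\mathcal{T}_{E_T^\infty}(T_{\delta_L\check d\delta_R})\leftrightarrow_b^\Delta\mathcal{T}_{E_T\cup E_Q^\infty}([H_d\parallel Q_{\delta_R\bot\delta_L}]_{\{i,o\}})$.
   Context: Process calculus. Fix a finite set $\mathcal{A}$ of actions, $\tau\notin\mathcal{A}$, a finite data set $\mathcal{D}$ with blank $\Box\notin\mathcal{D}$, $\mathcal{D}_\Box=\mathcal{D}\cup\{\Box\}$, extra symbols $\bot,\$\notin\mathcal{D}_\Box$, and channels including $i,o,r,w,m$. For a set $C'$ of channels, $I_{C'}=\{c?v,c!v\mid c\in C'\}$, $v$ ranging over communicated values (including $\mathcal{D}_\Box$, $L$, $R$, $\bot$, $\$$). Process expressions: $p::=0\mid 1\mid a.p\mid p+p\mid[p\parallel p]_{C'}\mid X$. A recursive specification $E$ is a set of equations $X\stackrel{def}{=}p$, at most one per name, with defining equations for all names used. Rules ($p\downarrow$ = termination): $1\downarrow$; $a.p\xrightarrow{a}p$; $p+q$ has the transitions of $p$ and $q$ and terminates if either does; $[p\parallel q]_{C'}\xrightarrow{a}[p'\parallel q]_{C'}$ if $p\xrightarrow{a}p'$, $a\notin I_{C'}$, and symmetrically; $[p\parallel q]_{C'}\xrightarrow{\tau}[p'\parallel q']_{C'}$ if for some $c\in C'$ and $v$, $p\xrightarrow{c?v}p'$, $q\xrightarrow{c!v}q'$ or vice versa; $[p\parallel q]_{C'}\downarrow$ iff both terminate;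 names behave as their defining right-hand sides. $\mathcal{T}_E(p)$: expressions reachable from $p$, initial $p$, final those $q$ with $q\downarrow$. Tape instances: finite sequences over $\mathcal{D}_\Box$ and marked symbols $\check d$ with exactly one marked symbol, identified modulo blanks at the ends; for $\delta\in\mathcal{D}_\Box^*$, $\overleftarrow{\delta}$ (resp. $\overrightarrow{\delta}$) marks its rightmost (resp. leftmost) symbol, or is $\check\Box$ if $\delta$ is empty. $E_T^\infty$: for all $d,\delta_L,\delta_R$: $T_{\delta_L\check d\delta_R}\stackrel{def}{=}r!d.T_{\delta_L\check d\delta_R}+\sum_{e\in\mathcal{D}_\Box}w?e.T_{\delta_L\check e\delta_R}+m?L.T_{\overleftarrow{\delta_L}d\delta_R}+m?R.T_{\delta_Ld\overrightarrow{\delta_R}}+1$. Queue $E_Q^\infty$ (over $\Delta=\mathcal{D}_\Box\cup\{\bot,\$\}$): $Q_\varepsilon\stackrel{def}{=}\sum_{x\in\Delta}i?x.Q_x+1$, $Q_{\sigma x}\stackrel{def}{=}o!x.Q_\sigma+\sum_{y\in\Delta}i?y.Q_{y\sigma x}+1$. Controller $E_T$: $H_d\stackrel{def}{=}r!d.H_d+\sum_{e\in\mathcal{D}_\Box}w?e.H_e+m?L.H^L_d+m?R.H^R_d+1$; $H^L_d\stackrel{def}{=}i!d.(\sum_{e\in\mathcal{D}_\Box}o?e.H_e+o?\bot.i!\$.i!\bot.\mathit{Back})$; $\mathit{Back}\stackrel{def}{=}\sum_{e\in\mathcal{D}_\Box}o?e.i!e.\mathit{Back}+o?\$.H_\Box$;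 $H^R_d\stackrel{def}{=}i!\$.i!d.(\sum_{e\in\mathcal{D}_\Box}o?e.\mathit{Fwd}_e+o?\bot.\mathit{Fwd}_\bot)$; $\mathit{Fwd}_d\stackrel{def}{=}\sum_{e\in\mathcal{D}_\Box}o?e.i!d.\mathit{Fwd}_e+o?\bot.i!d.\mathit{Fwd}_\bot+o?\$.H_d$; $\mathit{Fwd}_\bot\stackrel{def}{=}\sum_{e\in\mathcal{D}_\Box}o?e.i!\bot.\mathit{Fwd}_e+o?\$.i!\bot.H_\Box$. Divergence-preserving branching bisimilarity $\leftrightarrow_b^\Delta$: write $s\xrightarrow{(a)}t$ if $s\xrightarrow{a}t$ or ($a=\tau$ and $s=t$); $\twoheadrightarrow$ / $\twoheadrightarrow^+$ are reflexive-transitive / transitive closures of $\xrightarrow{\tau}$. A relation $\mathcal{R}$ is a divergence-preserving branching bisimulation if $s_1\mathcal{R}s_2$ implies: (1) $s_1\xrightarrow{a}s_1'$ gives $s_2\twoheadrightarrow s_2''\xrightarrow{(a)}s_2'$ with $s_1\mathcal{R}s_2''$, $s_1'\mathcal{R}s_2'$; (2) symmetrically; (3) if $s_1$ final then $s_2\twoheadrightarrow s_2'$ final with $s_1\mathcal{R}s_2'$; (4) symmetrically; (5) an infinite $\tau$-sequence from $s_1$ with all states related to $s_2$ gives $s_2\twoheadrightarrow^+s_2'$ with $s_2'$ related to some state of the sequence; (6) symmetrically. Two transition systems are $\leftrightarrow_b^\Delta$ if such a relation relates their initial states. *)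

theory Defs
  imports Main
begin

section \<open>Transition systems and divergence-preserving branching bisimilarity\<close>

datatype ('c, 'v, 'a) action =
    Tau ("\<tau>")
  | Receive 'c 'v (infix "\<questiondown>" 95)
  | Send 'c 'v (infix "\<exclamdown>" 95)
  | Basic 'a

record ('s, 'l) lts =
  states :: "'s set"
  trans :: "('s \<times> 'l \<times> 's) set"
  initial :: "'s"
  final :: "'s set"

definition tau_step :: "('s, ('c, 'v, 'a) action) lts \<Rightarrow> 's \<Rightarrow> 's \<Rightarrow> bool" where
  "tau_step T s t \<longleftrightarrow> (s, \<tau>, t) \<in> trans T"

definition opt_step ::
    "('s, ('c, 'v, 'a) action) lts \<Rightarrow> 's \<Rightarrow> ('c, 'v, 'a) action \<Rightarrow> 's \<Rightarrow> bool" where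
  "opt_step T s a t \<longleftrightarrow> (s, a, t) \<in> trans T \<or> (a = \<tau> \<and> s = t)"

text \<open>One direction of the six transfer conditions. The symmetric conditions are obtained below by
  applying it to the converse relation.\<close>

definition db_transfer ::
    "('s, ('c, 'v, 'a) action) lts \<Rightarrow> ('t, ('c, 'v, 'a) action) lts \<Rightarrow> ('s \<Rightarrow> 't \<Rightarrow> bool) \<Rightarrow> bool" where
  "db_transfer T1 T2 R \<longleftrightarrow> (\<forall>s1 s2. R s1 s2 \<longrightarrow>
     (\<forall>a s1'. (s1, a, s1') \<in> trans T1 \<longrightarrow>
        (\<exists>s2'' s2'. (tau_step T2)\<^sup>*\<^sup>* s2 s2'' \<and> opt_step T2 s2'' a s2' \<and> R s1 s2'' \<and> R s1' s2'))
   \<and> (s1 \<in> final T1 \<longrightarrow>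
        (\<exists>s2'. (tau_step T2)\<^sup>*\<^sup>* s2 s2' \<and> s2' \<in> final T2 \<and> R s1 s2'))
   \<and> (\<forall>f :: nat \<Rightarrow> 's. f 0 = s1 \<and> (\<forall>n. tau_step T1 (f n) (f (Suc n))) \<and> (\<forall>n. R (f n) s2) \<longrightarrow>
        (\<exists>s2' n. (tau_step T2)\<^sup>+\<^sup>+ s2 s2' \<and> R (f n) s2')))"

definition db_bisimulation ::
    "('s, ('c, 'v, 'a) action) lts \<Rightarrow> ('t, ('c, 'v, 'a) action) lts \<Rightarrow> ('s \<Rightarrow> 't \<Rightarrow> bool) \<Rightarrow> bool" where
  "db_bisimulation T1 T2 R \<longleftrightarrow>
     (\<forall>s t. R s t \<longrightarrow> s \<in> states T1 \<and> t \<in> states T2) \<and>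
     db_transfer T1 T2 R \<and> db_transfer T2 T1 R\<inverse>\<inverse>"

definition db_bisimilar ::
    "('s, ('c, 'v, 'a) action) lts \<Rightarrow> ('t, ('c, 'v, 'a) action) lts \<Rightarrow> bool"
    (infix "\<leftrightarrow>\<^sub>b\<^sup>\<Delta>" 50) where
  "T1 \<leftrightarrow>\<^sub>b\<^sup>\<Delta> T2 \<longleftrightarrow> (\<exists>R. db_bisimulation T1 T2 R \<and> R (initial T1) (initial T2))"


section \<open>Process expressions\<close>

datatype (dead 'c, dead 'v, dead 'a, names: 'x) proc =
    Deadlock ("\<zero>")
  | Skip ("\<one>")
  | Prefix "('c, 'v, 'a) action" "('c, 'v, 'a, 'x) proc" (infixr "\<cdot>" 85)
  | Alt "('c, 'v, 'a, 'x) proc" "('c, 'v, 'a, 'x) proc" (infixr "\<oplus>" 75)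
  | Par "('c, 'v, 'a, 'x) proc" "('c, 'v, 'a, 'x) proc" "'c set" ("[_ \<parallel> _]'(_')" [0, 0, 0] 1000)
  | Name 'x

type_synonym ('c, 'v, 'a, 'x) spec = "('x \<times> ('c, 'v, 'a, 'x) proc) set"

definition recursive_spec :: "('c, 'v, 'a, 'x) spec \<Rightarrow> bool" where
  "recursive_spec E \<longleftrightarrow>
     (\<forall>X p q. (X, p) \<in> E \<and> (X, q) \<in> E \<longrightarrow> p = q) \<and>
     (\<forall>X p. (X, p) \<in> E \<longrightarrow> names p \<subseteq> Domain E)"

definition comm_actions :: "'c set \<Rightarrow> ('c, 'v, 'a) action set" where
  "comm_actions C = {c\<questiondown>v | c v. c \<in> C} \<union> {c\<exclamdown>v | c v. c \<in> C}"

inductive terminates :: "('c, 'v, 'a, 'x) spec \<Rightarrow> ('c, 'v, 'a, 'x) proc \<Rightarrow> bool"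
  for E where
  "terminates E \<one>"
| "terminates E p \<Longrightarrow> terminates E (p \<oplus> q)"
| "terminates E q \<Longrightarrow> terminates E (p \<oplus> q)"
| "terminates E p \<Longrightarrow> terminates E q \<Longrightarrow> terminates E [p \<parallel> q](C)"
| "(X, p) \<in> E \<Longrightarrow> terminates E p \<Longrightarrow> terminates E (Name X)"

inductive step ::
    "('c, 'v, 'a, 'x) spec \<Rightarrow> ('c, 'v, 'a, 'x) proc \<Rightarrow> ('c, 'v, 'a) action \<Rightarrow>
     ('c, 'v, 'a, 'x) proc \<Rightarrow> bool"
  for E where
  "step E (a\<cdot>p) a p"
| "step E p a p' \<Longrightarrow> step E (p \<oplus> q) a p'"
| "step E q a q' \<Longrightarrow> step E (p \<oplus> q) a q'"
| "step E p a p' \<Longrightarrow> a \<notin> comm_actions C \<Longrightarrow> step E [p \<parallel> q](C) a [p' \<parallel> q](C)"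
| "step E q a q' \<Longrightarrow> a \<notin> comm_actions C \<Longrightarrow> step E [p \<parallel> q](C) a [p \<parallel> q'](C)"
| "step E p (c\<questiondown>v) p' \<Longrightarrow> step E q (c\<exclamdown>v) q' \<Longrightarrow> c \<in> C \<Longrightarrow> step E [p \<parallel> q](C) \<tau> [p' \<parallel> q'](C)"
| "step E p (c\<exclamdown>v) p' \<Longrightarrow> step E q (c\<questiondown>v) q' \<Longrightarrow> c \<in> C \<Longrightarrow> step E [p \<parallel> q](C) \<tau> [p' \<parallel> q'](C)"
| "(X, p) \<in> E \<Longrightarrow> step E p a p' \<Longrightarrow> step E (Name X) a p'"

definition reachable ::
    "('c, 'v, 'a, 'x) spec \<Rightarrow> ('c, 'v, 'a, 'x) proc \<Rightarrow> ('c, 'v, 'a, 'x) proc set" where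
  "reachable E p = {q. (\<lambda>x y. \<exists>a. step E x a y)\<^sup>*\<^sup>* p q}"

definition lts_of ::
    "('c, 'v, 'a, 'x) spec \<Rightarrow> ('c, 'v, 'a, 'x) proc \<Rightarrow>
     (('c, 'v, 'a, 'x) proc, ('c, 'v, 'a) action) lts" where
  "lts_of E p = \<lparr>
     states = reachable E p,
     trans = {(q, a, q'). q \<in> reachable E p \<and> step E q a q'},
     initial = p,
     final = {q \<in> reachable E p. terminates E q} \<rparr>"

text \<open>Finite choice: summands are arranged in some fixed enumeration of the index set; the empty
  sum is deadlock. The enumeration exists only for finite index sets.\<close>

fun alts :: "('c, 'v, 'a, 'x) proc list \<Rightarrow> ('c, 'v, 'a, 'x) proc" where
  "alts [] = \<zero>"
| "alts [p] = p"
| "alts (p # q # ps) = p \<oplus> alts (q # ps)"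

definition choice :: "'i set \<Rightarrow> ('i \<Rightarrow> ('c, 'v, 'a, 'x) proc) \<Rightarrow> ('c, 'v, 'a, 'x) proc" where
  "choice I p = alts (map p (SOME is. set is = I \<and> distinct is))"


section \<open>Tape instances\<close>

text \<open>The data set is a subset of the type parameter. The values \<open>Datum x\<close> with \<open>x\<close> outside that
  subset act as further communicated values that are not tape symbols.\<close>

datatype 'd val = Datum 'd | Blank ("\<box>") | Bottom ("\<bottom>") | Dollar | MoveLeft | MoveRight

definition with_blank :: "'d set \<Rightarrow> 'd val set" where
  "with_blank D = insert \<box> (Datum ` D)"

definition queue_symbols :: "'d set \<Rightarrow> 'd val set" where
  "queue_symbols D = with_blank D \<union> {\<bottom>, Dollar}"

datatype 'd cell = Plain "'d val" | Marked "'d val"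

definition tape_sequence :: "'d cell list \<Rightarrow> bool" where
  "tape_sequence u \<longleftrightarrow> length (filter (\<lambda>x. \<exists>d. x = Marked d) u) = 1"

abbreviation blanks :: "nat \<Rightarrow> 'd cell list" where
  "blanks n \<equiv> replicate n (Plain \<box>)"

definition blank_equiv :: "'d cell list \<Rightarrow> 'd cell list \<Rightarrow> bool" where
  "blank_equiv u v \<longleftrightarrow> tape_sequence u \<and> tape_sequence v \<and>
     (\<exists>j k j' k'. blanks j @ u @ blanks k = blanks j' @ v @ blanks k')"

lemma blank_equiv_trans:
  assumes "blank_equiv u v" "blank_equiv v w"
  shows "blank_equiv u w"
proof -
  obtain j k j' k' where 1: "blanks j @ u @ blanks k = blanks j' @ v @ blanks k'"
    using assms(1) unfolding blank_equiv_def by blast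
  obtain l m l' m' where 2: "blanks l @ v @ blanks m = blanks l' @ w @ blanks m'"
    using assms(2) unfolding blank_equiv_def by blast
  have "blanks (l + j) @ u @ blanks (k + m) = blanks l @ (blanks j @ u @ blanks k) @ blanks m"
    by (simp add: replicate_add)
  also have "\<dots> = (blanks l @ blanks j') @ v @ (blanks k' @ blanks m)"
    by (simp add: 1)
  also have "\<dots> = (blanks j' @ blanks l) @ v @ (blanks m @ blanks k')"
    by (simp add: add.commute flip: replicate_add)
  also have "\<dots> = blanks j' @ (blanks l @ v @ blanks m) @ blanks k'"
    by simp
  also have "\<dots> = blanks (j' + l') @ w @ blanks (m' + k')"
    by (simp add: 2 replicate_add)
  finally show ?thesis
    using assms unfolding blank_equiv_def by blast
qed

lemma blank_equiv_sym: "blank_equiv u v \<Longrightarrow> blank_equiv v u"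
  unfolding blank_equiv_def by metis

lemma blank_equiv_refl: "tape_sequence u \<Longrightarrow> blank_equiv u u"
  unfolding blank_equiv_def by blast

quotient_type 'd tape = "'d cell list" / partial: blank_equiv
proof (rule part_equivpI)
  have "blank_equiv [Marked \<box>] ([Marked \<box>] :: 'd cell list)"
    by (rule blank_equiv_refl) (simp add: tape_sequence_def)
  then show "\<exists>u :: 'd cell list. blank_equiv u u" ..
  show "symp (blank_equiv :: 'd cell list \<Rightarrow> _)"
    using blank_equiv_sym by (rule sympI)
  show "transp (blank_equiv :: 'd cell list \<Rightarrow> _)"
    using blank_equiv_trans by (rule transpI)
qed

definition mark_last :: "'d val list \<Rightarrow> 'd cell list" where
  "mark_last \<delta> =
     (if \<delta> = [] then [Marked \<box>] else map Plain (butlast \<delta>) @ [Marked (last \<delta>)])"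

definition mark_first :: "'d val list \<Rightarrow> 'd cell list" where
  "mark_first \<delta> =
     (if \<delta> = [] then [Marked \<box>] else Marked (hd \<delta>) # map Plain (tl \<delta>))"

definition tape_at :: "'d val list \<Rightarrow> 'd val \<Rightarrow> 'd val list \<Rightarrow> 'd tape" where
  "tape_at \<delta>\<^sub>L d \<delta>\<^sub>R = abs_tape (map Plain \<delta>\<^sub>L @ Marked d # map Plain \<delta>\<^sub>R)"


section \<open>The specifications of tape, queue and controller\<close>

datatype 'c channel = chan_i | chan_o | chan_r | chan_w | chan_m | Other_chan 'c

text \<open>The names \<open>Fwd d\<close> cover both the family indexed by tape symbols and the case \<open>d = \<bottom>\<close>.\<close>

datatype 'd name =
    T "'d tape"
  | Q "'d val list"
  | H "'d val"
  | HL "'d val"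
  | HR "'d val"
  | Back
  | Fwd "'d val"

type_synonym ('c, 'd, 'a) tape_spec = "('c channel, 'd val, 'a, 'd name) spec"

definition E_T_inf :: "'d set \<Rightarrow> ('c, 'd, 'a) tape_spec" where
  "E_T_inf D =
     {(T (tape_at \<delta>\<^sub>L d \<delta>\<^sub>R),
         chan_r\<exclamdown>d \<cdot> Name (T (tape_at \<delta>\<^sub>L d \<delta>\<^sub>R))
       \<oplus> choice (with_blank D) (\<lambda>e. chan_w\<questiondown>e \<cdot> Name (T (tape_at \<delta>\<^sub>L e \<delta>\<^sub>R)))
       \<oplus> chan_m\<questiondown>MoveLeft \<cdot> Name (T (abs_tape (mark_last \<delta>\<^sub>L @ Plain d # map Plain \<delta>\<^sub>R)))
       \<oplus> chan_m\<questiondown>MoveRight \<cdot> Name (T (abs_tape (map Plain \<delta>\<^sub>L @ Plain d # mark_first \<delta>\<^sub>R)))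
       \<oplus> \<one>)
     | \<delta>\<^sub>L d \<delta>\<^sub>R.
       d \<in> with_blank D \<and> \<delta>\<^sub>L \<in> lists (with_blank D) \<and> \<delta>\<^sub>R \<in> lists (with_blank D)}"

definition E_Q_inf :: "'d set \<Rightarrow> ('c, 'd, 'a) tape_spec" where
  "E_Q_inf D =
     {(Q [], choice (queue_symbols D) (\<lambda>x. chan_i\<questiondown>x \<cdot> Name (Q [x])) \<oplus> \<one>)}
   \<union> {(Q (\<sigma> @ [x]),
         chan_o\<exclamdown>x \<cdot> Name (Q \<sigma>)
       \<oplus> choice (queue_symbols D) (\<lambda>y. chan_i\<questiondown>y \<cdot> Name (Q (y # \<sigma> @ [x])))
       \<oplus> \<one>)
     | \<sigma> x. \<sigma> \<in> lists (queue_symbols D) \<and> x \<in> queue_symbols D}"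

definition E_T :: "'d set \<Rightarrow> ('c, 'd, 'a) tape_spec" where
  "E_T D =
     {(H d,
         chan_r\<exclamdown>d \<cdot> Name (H d)
       \<oplus> choice (with_blank D) (\<lambda>e. chan_w\<questiondown>e \<cdot> Name (H e))
       \<oplus> chan_m\<questiondown>MoveLeft \<cdot> Name (HL d)
       \<oplus> chan_m\<questiondown>MoveRight \<cdot> Name (HR d)
       \<oplus> \<one>)
     | d. d \<in> with_blank D}
   \<union> {(HL d,
         chan_i\<exclamdown>d \<cdot>
           (choice (with_blank D) (\<lambda>e. chan_o\<questiondown>e \<cdot> Name (H e))
            \<oplus> chan_o\<questiondown>\<bottom> \<cdot> chan_i\<exclamdown>Dollar \<cdot> chan_i\<exclamdown>\<bottom> \<cdot> Name Back))
     | d. d \<in> with_blank D}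
   \<union> {(Back,
         choice (with_blank D) (\<lambda>e. chan_o\<questiondown>e \<cdot> chan_i\<exclamdown>e \<cdot> Name Back)
       \<oplus> chan_o\<questiondown>Dollar \<cdot> Name (H \<box>))}
   \<union> {(HR d,
         chan_i\<exclamdown>Dollar \<cdot> chan_i\<exclamdown>d \<cdot>
           (choice (with_blank D) (\<lambda>e. chan_o\<questiondown>e \<cdot> Name (Fwd e))
            \<oplus> chan_o\<questiondown>\<bottom> \<cdot> Name (Fwd \<bottom>)))
     | d. d \<in> with_blank D}
   \<union> {(Fwd d,
         choice (with_blank D) (\<lambda>e. chan_o\<questiondown>e \<cdot> chan_i\<exclamdown>d \<cdot> Name (Fwd e))
       \<oplus> chan_o\<questiondown>\<bottom> \<cdot> chan_i\<exclamdown>d \<cdot> Name (Fwd \<bottom>)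
       \<oplus> chan_o\<questiondown>Dollar \<cdot> Name (H d))
     | d. d \<in> with_blank D}
   \<union> {(Fwd \<bottom>,
         choice (with_blank D) (\<lambda>e. chan_o\<questiondown>e \<cdot> chan_i\<exclamdown>\<bottom> \<cdot> Name (Fwd e))
       \<oplus> chan_o\<questiondown>Dollar \<cdot> chan_i\<exclamdown>\<bottom> \<cdot> Name (H \<box>))}"


section \<open>The specifications are recursive specifications\<close>

lemma names_alts: "names (alts ps) = (\<Union>p \<in> set ps. names p)"
  by (induction ps rule: alts.induct) auto

lemma names_choice:
  assumes "finite I"
  shows "names (choice I p) = (\<Union>i \<in> I. names (p i))"
proof -
  have "\<exists>is. set is = I \<and> distinct is"
    using assms finite_distinct_list by blast
  then have "set (SOME is. set is = I \<and> distinct is) = I"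
    by (rule someI2_ex) simp
  then show ?thesis
    by (simp add: choice_def names_alts)
qed

lemma tape_sequence_at: "tape_sequence (map Plain u @ Marked d # map Plain v)"
  by (simp add: tape_sequence_def filter_map o_def)

lemma tape_sequence_mark:
  "tape_sequence (mark_last u @ Plain d # map Plain v)"
  "tape_sequence (map Plain u @ Plain d # mark_first v)"
  by (auto simp: tape_sequence_def mark_last_def mark_first_def filter_map o_def)

lemma abs_tape_eq_iff:
  assumes "tape_sequence u" "tape_sequence v"
  shows "abs_tape u = abs_tape v \<longleftrightarrow> blank_equiv u v"
  using Quotient3_rel[OF Quotient3_tape, of u v] assms blank_equiv_refl by metis

lemma map_Plain_Marked_eq:
  assumes "map Plain u @ Marked d # v = map Plain u' @ Marked d' # v'"
  shows "u = u' \<and> d = d' \<and> v = v'"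
  using assms
proof (induction u arbitrary: u')
  case Nil
  then show ?case by (cases u') auto
next
  case (Cons x u)
  then show ?case by (cases u') auto
qed

lemma tape_at_eq_iff:
  "tape_at u d v = tape_at u' d' v' \<longleftrightarrow>
     d = d' \<and>
     (\<exists>j j'. replicate j \<box> @ u = replicate j' \<box> @ u') \<and>
     (\<exists>k k'. v @ replicate k \<box> = v' @ replicate k' \<box>)"
proof -
  have "blanks j @ (map Plain u @ Marked d # map Plain v) @ blanks k =
        blanks j' @ (map Plain u' @ Marked d' # map Plain v') @ blanks k' \<longleftrightarrow>
        replicate j \<box> @ u = replicate j' \<box> @ u' \<and> d = d' \<and>
        v @ replicate k \<box> = v' @ replicate k' \<box>" for j k j' k'
  proof -
    have eq: "blanks j @ (map Plain u @ Marked d # map Plain v) @ blanks k =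
      map Plain (replicate j \<box> @ u) @ Marked d # map Plain (v @ replicate k \<box>)"
      for j u d v k by simp
    have "inj (map Plain)" by (simp add: inj_def)
    then show ?thesis
      unfolding eq using map_Plain_Marked_eq by (metis injD)
  qed
  then show ?thesis
    unfolding tape_at_def abs_tape_eq_iff[OF tape_sequence_at tape_sequence_at]
    by (auto simp: blank_equiv_def tape_sequence_at)
qed

lemma mark_last_blanks: "\<exists>i. mark_last (replicate j \<box> @ u) = blanks i @ mark_last u"
proof (cases "u = []")
  case True
  then show ?thesis
  proof (cases j)
    case (Suc i)
    then have "mark_last (replicate j \<box> @ u) = blanks i @ mark_last u"
      using True by (simp add: mark_last_def replicate_append_same[symmetric] del: replicate_Suc)
        (metis append_is_Nil_conv butlast_snoc last_snoc list.distinct(1) map_replicate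
          replicate_Suc replicate_append_same)
    then show ?thesis ..
  qed (auto intro: exI[of _ 0])
next
  case False
  then have "mark_last (replicate j \<box> @ u) = blanks j @ mark_last u"
    by (simp add: mark_last_def butlast_append)
  then show ?thesis ..
qed

lemma mark_first_blanks: "\<exists>i. mark_first (v @ replicate k \<box>) = mark_first v @ blanks i"
proof (cases "v = []")
  case True
  then show ?thesis by (cases k) (auto simp: mark_first_def)
next
  case False
  then have "mark_first (v @ replicate k \<box>) = mark_first v @ blanks k"
    by (simp add: mark_first_def)
  then show ?thesis ..
qed

lemma tape_moves_cong:
  assumes "tape_at u d v = tape_at u' d v'"
  shows "abs_tape (mark_last u @ Plain d # map Plain v) =
         abs_tape (mark_last u' @ Plain d # map Plain v')" (is ?left)
    and "abs_tape (map Plain u @ Plain d # mark_first v) =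
         abs_tape (map Plain u' @ Plain d # mark_first v')" (is ?right)
proof -
  obtain j j' where u: "replicate j \<box> @ u = replicate j' \<box> @ u'"
    using assms by (auto simp: tape_at_eq_iff)
  obtain k k' where v: "v @ replicate k \<box> = v' @ replicate k' \<box>"
    using assms by (auto simp: tape_at_eq_iff)
  obtain i i' where "mark_last (replicate j \<box> @ u) = blanks i @ mark_last u"
      "mark_last (replicate j' \<box> @ u') = blanks i' @ mark_last u'"
    using mark_last_blanks by blast
  then have ml: "blanks i @ mark_last u = blanks i' @ mark_last u'"
    unfolding u by simp
  obtain l l' where "mark_first (v @ replicate k \<box>) = mark_first v @ blanks l"
      "mark_first (v' @ replicate k' \<box>) = mark_first v' @ blanks l'"
    using mark_first_blanks by blast
  then have mf: "mark_first v @ blanks l = mark_first v' @ blanks l'"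
    unfolding v by simp
  have u': "blanks j @ map Plain u = blanks j' @ map Plain u'"
    using arg_cong[OF u, of "map Plain"] by simp
  have v': "map Plain v @ blanks k = map Plain v' @ blanks k'"
    using arg_cong[OF v, of "map Plain"] by simp
  have "blanks i @ (mark_last u @ Plain d # map Plain v) @ blanks k =
        blanks i' @ (mark_last u' @ Plain d # map Plain v') @ blanks k'"
    using arg_cong2[OF ml v', of "\<lambda>x y. x @ Plain d # y"] by simp
  then show ?left
    by (subst abs_tape_eq_iff) (use tape_sequence_mark in \<open>auto simp: blank_equiv_def\<close>)
  have "blanks j @ (map Plain u @ Plain d # mark_first v) @ blanks l =
        blanks j' @ (map Plain u' @ Plain d # mark_first v') @ blanks l'"
    using arg_cong2[OF u' mf, of "\<lambda>x y. x @ Plain d # y"] by simp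
  then show ?right
    by (subst abs_tape_eq_iff) (use tape_sequence_mark in \<open>auto simp: blank_equiv_def\<close>)
qed

lemma mark_last_shape:
  assumes "u \<in> lists (with_blank D)"
  shows "\<exists>u' e. mark_last u = map Plain u' @ [Marked e] \<and>
           u' \<in> lists (with_blank D) \<and> e \<in> with_blank D"
proof (cases u rule: rev_cases)
  case Nil
  then show ?thesis
    by (intro exI[of _ "[]"] exI[of _ \<box>]) (simp add: mark_last_def with_blank_def)
next
  case (snoc u' e)
  then show ?thesis
    using assms by (intro exI[of _ u'] exI[of _ e]) (simp add: mark_last_def)
qed

lemma mark_first_shape:
  assumes "v \<in> lists (with_blank D)"
  shows "\<exists>v' e. mark_first v = Marked e # map Plain v' \<and>
           v' \<in> lists (with_blank D) \<and> e \<in> with_blank D"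
proof (cases v)
  case Nil
  then show ?thesis
    by (intro exI[of _ "[]"] exI[of _ \<box>]) (simp add: mark_first_def with_blank_def)
next
  case (Cons e v')
  then show ?thesis
    using assms by (intro exI[of _ v'] exI[of _ e]) (simp add: mark_first_def)
qed

lemma Domain_E_T_inf:
  "Domain (E_T_inf D) =
     {T (tape_at u d v) | u d v.
        d \<in> with_blank D \<and> u \<in> lists (with_blank D) \<and> v \<in> lists (with_blank D)}"
  unfolding E_T_inf_def by blast

lemma tape_moves_in_Domain:
  assumes "d \<in> with_blank D" "u \<in> lists (with_blank D)" "v \<in> lists (with_blank D)"
  shows "T (abs_tape (mark_last u @ Plain d # map Plain v)) \<in> Domain (E_T_inf D)"
    and "T (abs_tape (map Plain u @ Plain d # mark_first v)) \<in> Domain (E_T_inf D)"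
proof -
  obtain u' e where "mark_last u = map Plain u' @ [Marked e]"
      "u' \<in> lists (with_blank D)" "e \<in> with_blank D"
    using mark_last_shape assms by blast
  then have "abs_tape (mark_last u @ Plain d # map Plain v) = tape_at u' e (d # v)"
    "d # v \<in> lists (with_blank D)"
    using assms by (simp_all add: tape_at_def)
  then show "T (abs_tape (mark_last u @ Plain d # map Plain v)) \<in> Domain (E_T_inf D)"
    using \<open>u' \<in> _\<close> \<open>e \<in> _\<close> unfolding Domain_E_T_inf by blast
  obtain v' e where "mark_first v = Marked e # map Plain v'"
      "v' \<in> lists (with_blank D)" "e \<in> with_blank D"
    using mark_first_shape assms by blast
  then have "abs_tape (map Plain u @ Plain d # mark_first v) = tape_at (u @ [d]) e v'"
    "u @ [d] \<in> lists (with_blank D)"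
    using assms by (simp_all add: tape_at_def)
  then show "T (abs_tape (map Plain u @ Plain d # mark_first v)) \<in> Domain (E_T_inf D)"
    using \<open>v' \<in> _\<close> \<open>e \<in> _\<close> unfolding Domain_E_T_inf by blast
qed

text \<open>In particular, the equation for a tape name does not depend on the chosen representative.\<close>

lemma recursive_spec_E_T_inf:
  assumes "finite D"
  shows "recursive_spec (E_T_inf D :: ('c, 'd, 'a) tape_spec)"
  unfolding recursive_spec_def
proof (intro conjI allI impI)
  fix X and p q :: "('c channel, 'd val, 'a, 'd name) proc"
  assume "(X, p) \<in> E_T_inf D \<and> (X, q) \<in> E_T_inf D"
  then obtain u d v u' d' v' where
    X: "X = T (tape_at u d v)" "X = T (tape_at u' d' v')" and
    p: "p = chan_r\<exclamdown>d \<cdot> Name (T (tape_at u d v))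
       \<oplus> choice (with_blank D) (\<lambda>e. chan_w\<questiondown>e \<cdot> Name (T (tape_at u e v)))
       \<oplus> chan_m\<questiondown>MoveLeft \<cdot> Name (T (abs_tape (mark_last u @ Plain d # map Plain v)))
       \<oplus> chan_m\<questiondown>MoveRight \<cdot> Name (T (abs_tape (map Plain u @ Plain d # mark_first v)))
       \<oplus> \<one>" and
    q: "q = chan_r\<exclamdown>d' \<cdot> Name (T (tape_at u' d' v'))
       \<oplus> choice (with_blank D) (\<lambda>e. chan_w\<questiondown>e \<cdot> Name (T (tape_at u' e v')))
       \<oplus> chan_m\<questiondown>MoveLeft \<cdot> Name (T (abs_tape (mark_last u' @ Plain d' # map Plain v')))
       \<oplus> chan_m\<questiondown>MoveRight \<cdot> Name (T (abs_tape (map Plain u' @ Plain d' # mark_first v')))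
       \<oplus> \<one>"
    unfolding E_T_inf_def by blast
  have eq: "tape_at u d v = tape_at u' d' v'" using X by simp
  then have d: "d' = d" by (simp add: tape_at_eq_iff)
  have "tape_at u e v = tape_at u' e v'" for e
    using eq by (simp add: tape_at_eq_iff)
  then show "p = q"
    using tape_moves_cong[OF eq[unfolded d]] by (simp add: p q d)
next
  fix X and p :: "('c channel, 'd val, 'a, 'd name) proc"
  assume "(X, p) \<in> E_T_inf D"
  then obtain u d v where in_D:
      "d \<in> with_blank D" "u \<in> lists (with_blank D)" "v \<in> lists (with_blank D)" and
    p: "p = chan_r\<exclamdown>d \<cdot> Name (T (tape_at u d v))
       \<oplus> choice (with_blank D) (\<lambda>e. chan_w\<questiondown>e \<cdot> Name (T (tape_at u e v)))
       \<oplus> chan_m\<questiondown>MoveLeft \<cdot> Name (T (abs_tape (mark_last u @ Plain d # map Plain v)))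
       \<oplus> chan_m\<questiondown>MoveRight \<cdot> Name (T (abs_tape (map Plain u @ Plain d # mark_first v)))
       \<oplus> \<one>"
    unfolding E_T_inf_def by blast
  have "finite (with_blank D)" using assms by (simp add: with_blank_def)
  moreover have "T (tape_at u e v) \<in> Domain (E_T_inf D)" if "e \<in> with_blank D" for e
    using in_D that unfolding Domain_E_T_inf by blast
  ultimately show "names p \<subseteq> Domain (E_T_inf D :: ('c, 'd, 'a) tape_spec)"
    using tape_moves_in_Domain[OF in_D] in_D by (auto simp: p names_choice)
qed

lemma recursive_spec_E_T_E_Q_inf:
  assumes "finite D"
  shows "recursive_spec (E_T D \<union> E_Q_inf D :: ('c, 'd, 'a) tape_spec)"
  unfolding recursive_spec_def
proof (intro conjI allI impI)
  fix X and p q :: "('c channel, 'd val, 'a, 'd name) proc"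
  assume "(X, p) \<in> E_T D \<union> E_Q_inf D \<and> (X, q) \<in> E_T D \<union> E_Q_inf D"
  then show "p = q"
    unfolding E_T_def E_Q_inf_def with_blank_def by (cases X) auto
next
  have fin: "finite (with_blank D)" "finite (queue_symbols D)"
    using assms by (simp_all add: with_blank_def queue_symbols_def)
  have dom_Q: "Q \<sigma> \<in> Domain (E_T D \<union> E_Q_inf D :: ('c, 'd, 'a) tape_spec)"
    if "\<sigma> \<in> lists (queue_symbols D)" for \<sigma>
  proof (cases \<sigma> rule: rev_cases)
    case Nil
    then show ?thesis unfolding E_Q_inf_def by blast
  next
    case (snoc \<rho> x)
    then have "\<rho> \<in> lists (queue_symbols D)" "x \<in> queue_symbols D" using that by auto
    then show ?thesis unfolding E_Q_inf_def snoc by blast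
  qed
  have dom_T: "H d \<in> Domain (E_T D \<union> E_Q_inf D :: ('c, 'd, 'a) tape_spec)"
      "HL d \<in> Domain (E_T D \<union> E_Q_inf D :: ('c, 'd, 'a) tape_spec)"
      "HR d \<in> Domain (E_T D \<union> E_Q_inf D :: ('c, 'd, 'a) tape_spec)"
      "Fwd d \<in> Domain (E_T D \<union> E_Q_inf D :: ('c, 'd, 'a) tape_spec)"
    if "d \<in> with_blank D" for d
    using that unfolding E_T_def by blast+
  have dom_rest: "Back \<in> Domain (E_T D \<union> E_Q_inf D :: ('c, 'd, 'a) tape_spec)"
      "Fwd \<bottom> \<in> Domain (E_T D \<union> E_Q_inf D :: ('c, 'd, 'a) tape_spec)"
    unfolding E_T_def by blast+
  have blank: "\<box> \<in> with_blank D" by (simp add: with_blank_def)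
  fix X and p :: "('c channel, 'd val, 'a, 'd name) proc"
  assume "(X, p) \<in> E_T D \<union> E_Q_inf D"
  then consider "(X, p) \<in> E_T D" | "(X, p) \<in> E_Q_inf D" by blast
  then show "names p \<subseteq> Domain (E_T D \<union> E_Q_inf D :: ('c, 'd, 'a) tape_spec)"
  proof cases
    case 1
    have "names p \<subseteq> H ` with_blank D \<union> HL ` with_blank D \<union> HR ` with_blank D \<union>
        Fwd ` with_blank D \<union> {Back, Fwd \<bottom>}"
      using 1 blank unfolding E_T_def
      by (elim UnE; clarsimp simp: names_choice fin(1) split: if_splits; blast)
    also have "\<dots> \<subseteq> Domain (E_T D \<union> E_Q_inf D :: ('c, 'd, 'a) tape_spec)"
      by (intro Un_least image_subsetI insert_subsetI empty_subsetI dom_T dom_rest)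
    finally show ?thesis .
  next
    case 2
    have "names p \<subseteq> Q ` lists (queue_symbols D)"
      using 2 unfolding E_Q_inf_def by (auto simp: names_choice fin(2) intro!: imageI)
    then show ?thesis using dom_Q by blast
  qed
qed

end

(* Between two moves the controller and the queue exchange messages deterministically: every
   intermediate state is non-final and has exactly one transition, a silent one, and the exchange
   ends in a state [H_e || Q_(v bot u)] representing the moved tape. So all intermediate states can
   be related to that tape, and neither side diverges. A tape name is related to the states of all
   of its representatives (u, d, v), since the queue contents are not taken modulo blanks. *)

theory Submission
  imports Defs
begin

section \<open>Operational rules as equivalences\<close>

lemma step_simps [simp]:
  "\<not> step E \<zero> a q"
  "\<not> step E \<one> a q"
  "step E (b \<cdot> p) a q \<longleftrightarrow> a = b \<and> q = p"
  "step E (p \<oplus> p') a q \<longleftrightarrow> step E p a q \<or> step E p' a q"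
  by (auto elim: step.cases intro: step.intros)

lemma terminates_simps [simp]:
  "\<not> terminates E \<zero>"
  "terminates E \<one>"
  "\<not> terminates E (b \<cdot> p)"
  "terminates E (p \<oplus> p') \<longleftrightarrow> terminates E p \<or> terminates E p'"
  "terminates E [p \<parallel> p'](C) \<longleftrightarrow> terminates E p \<and> terminates E p'"
  by (auto elim: terminates.cases intro: terminates.intros)

lemma step_Par_iff:
  "step E [p \<parallel> q](C) a r \<longleftrightarrow>
     (\<exists>p'. step E p a p' \<and> a \<notin> comm_actions C \<and> r = [p' \<parallel> q](C)) \<or>
     (\<exists>q'. step E q a q' \<and> a \<notin> comm_actions C \<and> r = [p \<parallel> q'](C)) \<or>
     (\<exists>c v p' q'. c \<in> C \<and> a = \<tau> \<and> r = [p' \<parallel> q'](C) \<and>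
        (step E p (c\<questiondown>v) p' \<and> step E q (c\<exclamdown>v) q' \<or>
         step E p (c\<exclamdown>v) p' \<and> step E q (c\<questiondown>v) q'))"
  (is "?l \<longleftrightarrow> ?r")
proof
  show "?l \<Longrightarrow> ?r" by (erule step.cases) auto
  show "?r \<Longrightarrow> ?l" by (auto intro: step.intros)
qed

text \<open>Inverting the rule for names yields some equation for \<open>X\<close>; uniqueness of
  equations in a recursive specification makes it the given one.\<close>

lemma Name_unfold:
  assumes "recursive_spec E" "(X, p) \<in> E"
  shows "step E (Name X) a q \<longleftrightarrow> step E p a q"
    and "terminates E (Name X) \<longleftrightarrow> terminates E p"
proof -
  have unique: "p' = p" if "(X, p') \<in> E" for p'
    using assms that unfolding recursive_spec_def by blast
  have "step E p a q" if "step E (Name X) a q"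
    using that by cases (use unique in simp)
  then show "step E (Name X) a q \<longleftrightarrow> step E p a q"
    using assms(2) by (blast intro: step.intros)
  have "terminates E p" if "terminates E (Name X)"
    using that by cases (use unique in simp)
  then show "terminates E (Name X) \<longleftrightarrow> terminates E p"
    using assms(2) by (blast intro: terminates.intros)
qed

section \<open>Finite sums\<close>

lemma step_alts: "step E (alts ps) a q \<longleftrightarrow> (\<exists>p \<in> set ps. step E p a q)"
  by (induction ps rule: alts.induct) auto

lemma terminates_alts: "terminates E (alts ps) \<longleftrightarrow> (\<exists>p \<in> set ps. terminates E p)"
  by (induction ps rule: alts.induct) auto

text \<open>A finite set has a distinct enumeration, so the \<open>SOME\<close> in
  \<open>choice\<close> denotes one. Transitions and termination of a sum then depend only on its
  set of summands.\<close>

lemma set_choice_enumeration: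
  assumes "finite I"
  shows "set (SOME is. set is = I \<and> distinct is) = I"
  by (rule someI2_ex[OF finite_distinct_list[OF assms]]) simp

lemma step_choice:
  "finite I \<Longrightarrow> step E (choice I p) a q \<longleftrightarrow> (\<exists>i \<in> I. step E (p i) a q)"
  by (simp add: choice_def step_alts set_choice_enumeration)

lemma terminates_choice:
  "finite I \<Longrightarrow> terminates E (choice I p) \<longleftrightarrow> (\<exists>i \<in> I. terminates E (p i))"
  by (simp add: choice_def terminates_alts set_choice_enumeration)


section \<open>Deterministic silent computations\<close>

text \<open>Captures the exchanges between two tape configurations. The inductive reading forces the
  silent path to be finite; the unique step and non-termination ensure that no behaviour is lost or
  gained on the way.\<close>

inductive settles ::
    "('c, 'v, 'a, 'x) spec \<Rightarrow> (('c, 'v, 'a, 'x) proc \<Rightarrow> bool) \<Rightarrow> ('c, 'v, 'a, 'x) proc \<Rightarrow> bool"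
  for E P where
  settled: "P p \<Longrightarrow> settles E P p"
| silent: "(\<And>a r. step E p a r \<longleftrightarrow> a = \<tau> \<and> r = q) \<Longrightarrow> \<not> terminates E p \<Longrightarrow>
    settles E P q \<Longrightarrow> settles E P p"

section \<open>Following a silent path within a transition system\<close>

lemma reachable_step: "q \<in> reachable E p \<Longrightarrow> step E q a r \<Longrightarrow> r \<in> reachable E p"
  unfolding reachable_def by (auto intro: rtranclp.rtrancl_into_rtrancl)

lemma settles_weak_step:
  assumes "settles F P q" "q \<in> reachable F q0"
  shows "\<exists>q'. (tau_step (lts_of F q0))\<^sup>*\<^sup>* q q' \<and> P q' \<and> q' \<in> reachable F q0"
  using assms
proof induction
  case (settled p)
  then show ?case by blast
next
  case (silent p q)
  have "step F p \<tau> q" using silent.hyps(1) by simp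
  then have "tau_step (lts_of F q0) p q" "q \<in> reachable F q0"
    using silent.prems by (auto simp: tau_step_def lts_of_def intro: reachable_step)
  then show ?case using silent.IH by (meson converse_rtranclp_into_rtranclp)
qed

text \<open>Uniqueness of each silent step keeps the sequence on the settling path, whose end
  satisfies \<open>P\<close> and has no silent step. The induction shifts the sequence by one
  position.\<close>

lemma settles_no_divergence:
  assumes "settles F P (f 0)" "\<And>q r. P q \<Longrightarrow> \<not> step F q \<tau> r"
  shows "\<not> (\<forall>n. step F (f n) \<tau> (f (Suc n)))"
  using assms(1)
proof (induction "f 0" arbitrary: f)
  case settled
  then show ?case using assms(2) by blast
next
  case (silent q)
  show ?case
  proof
    assume steps: "\<forall>n. step F (f n) \<tau> (f (Suc n))"
    then have "step F (f 0) \<tau> (f (Suc 0))" ..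
    then have "q = f (Suc 0)" unfolding silent.hyps(1) by simp
    then show False using silent.hyps(4)[of "\<lambda>n. f (Suc n)"] steps by simp
  qed
qed

text \<open>It suffices to match single transitions of \<open>S\<close>-related states, provided
  that the left state has no silent step and the answer on the right settles back into
  \<open>S\<close>. Intermediate states are then handled by the determinism built into
  \<open>settles\<close>.\<close>

lemma db_bisimilar_settles:
  fixes E F :: "('c, 'v, 'a, 'x) spec"
  assumes init: "S p0 q0"
    and forward: "\<And>p q a p'. S p q \<Longrightarrow> step E p a p' \<Longrightarrow> \<exists>q'. step F q a q' \<and> settles F (S p') q'"
    and backward: "\<And>p q a q'. S p q \<Longrightarrow> step F q a q' \<Longrightarrow> \<exists>p'. step E p a p' \<and> settles F (S p') q'"
    and final: "\<And>p q. S p q \<Longrightarrow> terminates E p \<longleftrightarrow> terminates F q"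
    and visible: "\<And>p q p'. S p q \<Longrightarrow> \<not> step E p \<tau> p'"
  shows "lts_of E p0 \<leftrightarrow>\<^sub>b\<^sup>\<Delta> lts_of F q0"
proof -
  \<comment> \<open>Reachability is included because a bisimulation may relate only states of the
    two systems. A left state is related to the whole silent path that leads to an
    \<open>S\<close>-partner.\<close>
  define R where "R p q \<longleftrightarrow> p \<in> reachable E p0 \<and> q \<in> reachable F q0 \<and> settles F (S p) q" for p q
  let ?E = "lts_of E p0" and ?F = "lts_of F q0"
  have weak: "\<exists>q'. (tau_step ?F)\<^sup>*\<^sup>* q q' \<and> S p q' \<and> R p q'" if "R p q" for p q
    using settles_weak_step[of F "S p" q q0] that settled unfolding R_def by blast
  \<comment> \<open>A silent step of \<open>q\<close> would have to be answered by a silent step of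
    \<open>p\<close>, which \<open>visible\<close> excludes.\<close>
  have visible': "\<not> step F q \<tau> r" if "S p q" for p q r
    using backward[OF that] visible[OF that] by blast
  have "db_transfer ?E ?F R"
    unfolding db_transfer_def
  proof (intro allI impI conjI)
    fix p q a p'
    assume R: "R p q" and step: "(p, a, p') \<in> trans ?E"
    obtain q' where q': "(tau_step ?F)\<^sup>*\<^sup>* q q'" "S p q'" "R p q'" using weak[OF R] by blast
    obtain q'' where "step F q' a q''" "settles F (S p') q''"
      using forward[OF q'(2)] step by (auto simp: lts_of_def)
    then have "opt_step ?F q' a q''" "R p' q''"
      using q'(3) step by (auto simp: R_def opt_step_def lts_of_def intro: reachable_step)
    then show "\<exists>s2'' s2'. (tau_step ?F)\<^sup>*\<^sup>* q s2'' \<and> opt_step ?F s2'' a s2' \<and> R p s2'' \<and> R p' s2'"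
      using q' by blast
  next
    fix p q
    assume R: "R p q" and "p \<in> lts.final ?E"
    moreover obtain q' where "(tau_step ?F)\<^sup>*\<^sup>* q q'" "S p q'" "R p q'" using weak[OF R] by blast
    ultimately show "\<exists>s2'. (tau_step ?F)\<^sup>*\<^sup>* q s2' \<and> s2' \<in> lts.final ?F \<and> R p s2'"
      using final by (auto simp: lts_of_def R_def)
  next
    fix p q and f :: "nat \<Rightarrow> _"
    assume R: "R p q"
      and "f 0 = p \<and> (\<forall>n. tau_step ?E (f n) (f (Suc n))) \<and> (\<forall>n. R (f n) q)"
    \<comment> \<open>The divergence condition holds vacuously: \<open>p\<close> has an
      \<open>S\<close>-partner at the end of the path and thus no silent step.\<close>
    then have "step E p \<tau> (f (Suc 0))" by (auto simp: tau_step_def lts_of_def)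
    then show "\<exists>s2' n. (tau_step ?F)\<^sup>+\<^sup>+ q s2' \<and> R (f n) s2'"
      using weak[OF R] visible by blast
  qed
  moreover have "db_transfer ?F ?E R\<inverse>\<inverse>"
    unfolding db_transfer_def conversep_iff
  proof (intro allI impI conjI)
    fix q p a q'
    assume R: "R p q" and "(q, a, q') \<in> trans ?F"
    then have step: "step F q a q'" and q': "q' \<in> reachable F q0"
      by (auto simp: lts_of_def intro: reachable_step)
    from R have "settles F (S p) q" by (simp add: R_def)
    then show "\<exists>s2'' s2'. (tau_step ?E)\<^sup>*\<^sup>* p s2'' \<and> opt_step ?E s2'' a s2' \<and> R s2'' q \<and> R s2' q'"
    proof cases
      case settled
      then obtain p' where "step E p a p'" "settles F (S p') q'" using backward step by blast
      then have "opt_step ?E p a p'" "R p' q'"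
        using R q' by (auto simp: R_def opt_step_def lts_of_def intro: reachable_step)
      then show ?thesis using R by blast
    next
      case (silent r)
      \<comment> \<open>The only step of an intermediate state is silent and stays on the path
        towards an \<open>S\<close>-partner of \<open>p\<close>, so \<open>p\<close> answers by
        standing still.\<close>
      then have "a = \<tau>" "R p q'" using R step q' by (auto simp: R_def)
      then show ?thesis using R by (auto simp: opt_step_def)
    qed
  next
    fix q p
    assume R: "R p q" and q: "q \<in> lts.final ?F"
    from R have "settles F (S p) q" by (simp add: R_def)
    \<comment> \<open>A terminating state cannot be intermediate, so the path has length
      zero.\<close>
    then have "S p q" using q by cases (auto simp: lts_of_def)
    then have "p \<in> lts.final ?E" using final q R by (auto simp: lts_of_def R_def)
    then show "\<exists>s2'. (tau_step ?E)\<^sup>*\<^sup>* p s2' \<and> s2' \<in> lts.final ?E \<and> R s2' q"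
      using R by blast
  next
    fix q p and f :: "nat \<Rightarrow> _"
    assume "R p q"
      and f: "f 0 = q \<and> (\<forall>n. tau_step ?F (f n) (f (Suc n))) \<and> (\<forall>n. R p (f n))"
    then have "settles F (S p) (f 0)" by (simp add: R_def)
    then have "\<not> (\<forall>n. step F (f n) \<tau> (f (Suc n)))"
      using visible' by (rule settles_no_divergence)
    then show "\<exists>s2' n. (tau_step ?E)\<^sup>+\<^sup>+ p s2' \<and> R s2' (f n)"
      using f by (auto simp: tau_step_def lts_of_def)
  qed
  moreover have "R p0 q0"
    using settled[of "S p0" q0] init by (auto simp: R_def reachable_def)
  ultimately show ?thesis
    unfolding db_bisimilar_def db_bisimulation_def
    by (intro exI[of _ R]) (auto simp: lts_of_def R_def)
qed


section \<open>The controller and its queue\<close>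

abbreviation controller :: "'d set \<Rightarrow> ('c, 'd, 'a) tape_spec" where
  "controller D \<equiv> E_T D \<union> E_Q_inf D"

abbreviation with_queue ::
    "('c channel, 'd val, 'a, 'd name) proc \<Rightarrow> 'd val list \<Rightarrow>
     ('c channel, 'd val, 'a, 'd name) proc" where
  "with_queue p \<sigma> \<equiv> [p \<parallel> Name (Q \<sigma>)]({chan_i, chan_o})"

lemma finite_symbols:
  assumes "finite D"
  shows "finite (with_blank D)" "finite (queue_symbols D)"
  using assms by (simp_all add: with_blank_def queue_symbols_def)

lemma symbol_simps [simp]:
  "\<box> \<in> with_blank D"
  "\<bottom> \<notin> with_blank D"
  "Dollar \<notin> with_blank D"
  "\<bottom> \<in> queue_symbols D"
  "Dollar \<in> queue_symbols D"
  "x \<in> with_blank D \<Longrightarrow> x \<in> queue_symbols D"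
  by (auto simp: with_blank_def queue_symbols_def)

lemma with_blank_subset: "with_blank D \<subseteq> queue_symbols D"
  by auto

section \<open>Joint steps of a controller state and the queue\<close>

lemma step_queue:
  fixes D :: "'d set"
  assumes "finite D" "\<sigma> \<in> lists (queue_symbols D)"
  shows "step (controller D :: ('c, 'd, 'a) tape_spec) (Name (Q \<sigma>)) a q \<longleftrightarrow>
      (\<exists>x \<in> queue_symbols D. a = chan_i\<questiondown>x \<and> q = Name (Q (x # \<sigma>))) \<or>
      (\<exists>\<rho> x. \<sigma> = \<rho> @ [x] \<and> a = chan_o\<exclamdown>x \<and> q = Name (Q \<rho>))" (is ?step)
    and "terminates (controller D :: ('c, 'd, 'a) tape_spec) (Name (Q \<sigma>))" (is ?final)
proof -
  let ?E = "controller D :: ('c, 'd, 'a) tape_spec"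
  note unfold = Name_unfold[OF recursive_spec_E_T_E_Q_inf[OF assms(1)]]
  have "?step \<and> ?final"
  \<comment> \<open>The cases are the two queue equations. Lists hold the newest entry first, so the
    symbol to be sent next is the last one.\<close>
  proof (cases \<sigma> rule: rev_cases)
    case Nil
    have "(Q [], choice (queue_symbols D) (\<lambda>x. chan_i\<questiondown>x \<cdot> Name (Q [x])) \<oplus> \<one>) \<in> ?E"
      by (simp add: E_Q_inf_def)
    from unfold[OF this] show ?thesis
      using assms(1) by (simp add: Nil step_choice finite_symbols)
  next
    case (snoc \<rho> x)
    have "(Q (\<rho> @ [x]), chan_o\<exclamdown>x \<cdot> Name (Q \<rho>)
       \<oplus> choice (queue_symbols D) (\<lambda>y. chan_i\<questiondown>y \<cdot> Name (Q (y # \<rho> @ [x]))) \<oplus> \<one>) \<in> ?E"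
      using assms(2) unfolding snoc E_Q_inf_def by auto
    from unfold[OF this] show ?thesis
      using assms(1) by (auto simp add: snoc step_choice finite_symbols)
  qed
  then show ?step ?final by simp_all
qed

text \<open>The queue accepts every symbol of its alphabet, \<open>p\<close> can only send
  \<open>x\<close>, and the queue cannot act alone since its channels are encapsulated. Hence the
  handshake on \<open>chan_i\<close> is the only step.\<close>

lemma settles_send:
  fixes D :: "'d set"
  assumes "finite D" "settles (controller D) P (with_queue p' (x # \<sigma>))"
    and "\<sigma> \<in> lists (queue_symbols D)" "x \<in> queue_symbols D"
    and steps: "\<And>a q. step (controller D) p a q \<longleftrightarrow> a = chan_i\<exclamdown>x \<and> q = p'"
    and "\<not> terminates (controller D) p"
  shows "settles (controller D :: ('c, 'd, 'a) tape_spec) P (with_queue p \<sigma>)"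
proof (rule settles.silent)
  show "step (controller D) (with_queue p \<sigma>) a r \<longleftrightarrow> a = \<tau> \<and> r = with_queue p' (x # \<sigma>)" for a r
    using assms(4) unfolding step_Par_iff steps step_queue[OF assms(1,3)] comm_actions_def by auto
  show "\<not> terminates (controller D) (with_queue p \<sigma>)" using assms(6) by simp
qed (fact assms(2))

text \<open>Although \<open>p\<close> may offer many inputs on \<open>chan_o\<close>, the queue
  offers only its last symbol, so the choice is resolved uniquely. This makes the sums over received
  symbols deterministic in context.\<close>

lemma settles_receive:
  fixes D :: "'d set"
  assumes "finite D" "settles (controller D) P (with_queue p' \<sigma>)"
    and "\<sigma> @ [x] \<in> lists (queue_symbols D)"
    and input: "\<And>a q. step (controller D) p a q \<Longrightarrow> \<exists>y. a = chan_o\<questiondown>y"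
    and steps: "\<And>q. step (controller D) p (chan_o\<questiondown>x) q \<longleftrightarrow> q = p'"
    and "\<not> terminates (controller D) p"
  shows "settles (controller D :: ('c, 'd, 'a) tape_spec) P (with_queue p (\<sigma> @ [x]))"
proof (rule settles.silent)
  note queue = step_queue(1)[OF assms(1,3)]
  have recv: "c = chan_o" if "step (controller D) p (c\<questiondown>y) q" for c y q
    using input[OF that] by simp
  have no_send: "\<not> step (controller D) p (c\<exclamdown>y) q" for c y q
    using input[of "c\<exclamdown>y" q] by auto
  have blocked: "a \<in> comm_actions {chan_i, chan_o}" if "step (controller D) p a q" for a q
    using input[OF that] by (auto simp: comm_actions_def)
  show "step (controller D) (with_queue p (\<sigma> @ [x])) a r \<longleftrightarrow> a = \<tau> \<and> r = with_queue p' \<sigma>"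
    (is "?l \<longleftrightarrow> ?r") for a r
  proof
    assume ?l
    then consider (left) q where "step (controller D) p a q" "a \<notin> comm_actions {chan_i, chan_o}"
      | (right) q where "step (controller D) (Name (Q (\<sigma> @ [x]))) a q" "a \<notin> comm_actions {chan_i, chan_o}"
      | (sync) c y q q' where "step (controller D) p (c\<questiondown>y) q"
          "step (controller D) (Name (Q (\<sigma> @ [x]))) (c\<exclamdown>y) q'" "a = \<tau>" "r = [q \<parallel> q']({chan_i, chan_o})"
      unfolding step_Par_iff using no_send by blast
    then show ?r
    proof cases
      case left
      then show ?thesis using blocked by blast
    next
      case right
      then show ?thesis unfolding queue by (auto simp: comm_actions_def)
    next
      case sync
      then show ?thesis using recv[OF sync(1)] steps unfolding queue by simp
    qed
  next
    assume ?r
    have "step (controller D) p (chan_o\<questiondown>x) p'" by (simp add: steps)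
    moreover have "step (controller D) (Name (Q (\<sigma> @ [x]))) (chan_o\<exclamdown>x) (Name (Q \<sigma>))"
      by (simp add: queue)
    ultimately show ?l using \<open>?r\<close> unfolding step_Par_iff by blast
  qed
  show "\<not> terminates (controller D) (with_queue p (\<sigma> @ [x]))" using assms(6) by simp
qed (fact assms(2))

context
  fixes D :: "'d set" and E :: "('c, 'd, 'a) tape_spec"
    and P :: "('c channel, 'd val, 'a, 'd name) proc \<Rightarrow> bool"
  assumes fin: "finite D"
  defines "E \<equiv> controller D"
begin

lemma controller_unfold:
  assumes "(X, p) \<in> E"
  shows "step E (Name X) a q \<longleftrightarrow> step E p a q" "terminates E (Name X) \<longleftrightarrow> terminates E p"
  using Name_unfold[OF recursive_spec_E_T_E_Q_inf[OF fin] assms[unfolded E_def]]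
  unfolding E_def by blast+

lemmas send = settles_send[OF fin, where ?'c = 'c and ?'a = 'a, folded E_def]
lemmas receive = settles_receive[OF fin, where ?'c = 'c and ?'a = 'a, folded E_def]
lemmas choice_simps =
  step_choice[OF finite_symbols(1)[OF fin]]
  terminates_choice[OF finite_symbols(1)[OF fin]]

section \<open>Transitions of the controller names\<close>

lemma step_H:
  assumes "d \<in> with_blank D"
  shows "step E (Name (H d)) a q \<longleftrightarrow>
      a = chan_r\<exclamdown>d \<and> q = Name (H d) \<or>
      (\<exists>e \<in> with_blank D. a = chan_w\<questiondown>e \<and> q = Name (H e)) \<or>
      a = chan_m\<questiondown>MoveLeft \<and> q = Name (HL d) \<or>
      a = chan_m\<questiondown>MoveRight \<and> q = Name (HR d)" (is ?step)
    and "terminates E (Name (H d))" (is ?final)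
proof -
  have "(H d, chan_r\<exclamdown>d \<cdot> Name (H d)
       \<oplus> choice (with_blank D) (\<lambda>e. chan_w\<questiondown>e \<cdot> Name (H e))
       \<oplus> chan_m\<questiondown>MoveLeft \<cdot> Name (HL d)
       \<oplus> chan_m\<questiondown>MoveRight \<cdot> Name (HR d)
       \<oplus> \<one>) \<in> E"
    using assms unfolding E_def E_T_def by blast
  note unfold = controller_unfold[OF this]
  show ?step ?final unfolding unfold by (auto simp: choice_simps)
qed

lemma step_HL:
  assumes "d \<in> with_blank D"
  shows "step E (Name (HL d)) a q \<longleftrightarrow> a = chan_i\<exclamdown>d \<and>
      q = choice (with_blank D) (\<lambda>e. chan_o\<questiondown>e \<cdot> Name (H e))
            \<oplus> chan_o\<questiondown>\<bottom> \<cdot> chan_i\<exclamdown>Dollar \<cdot> chan_i\<exclamdown>\<bottom> \<cdot> Name Back" (is ?step)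
    and "\<not> terminates E (Name (HL d))" (is ?final)
proof -
  have "(HL d, chan_i\<exclamdown>d \<cdot>
           (choice (with_blank D) (\<lambda>e. chan_o\<questiondown>e \<cdot> Name (H e))
            \<oplus> chan_o\<questiondown>\<bottom> \<cdot> chan_i\<exclamdown>Dollar \<cdot> chan_i\<exclamdown>\<bottom> \<cdot> Name Back)) \<in> E"
    using assms unfolding E_def E_T_def by blast
  note unfold = controller_unfold[OF this]
  show ?step ?final unfolding unfold by simp_all
qed

lemma step_HR:
  assumes "d \<in> with_blank D"
  shows "step E (Name (HR d)) a q \<longleftrightarrow> a = chan_i\<exclamdown>Dollar \<and>
      q = chan_i\<exclamdown>d \<cdot>
           (choice (with_blank D) (\<lambda>e. chan_o\<questiondown>e \<cdot> Name (Fwd e))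
            \<oplus> chan_o\<questiondown>\<bottom> \<cdot> Name (Fwd \<bottom>))" (is ?step)
    and "\<not> terminates E (Name (HR d))" (is ?final)
proof -
  have "(HR d, chan_i\<exclamdown>Dollar \<cdot> chan_i\<exclamdown>d \<cdot>
           (choice (with_blank D) (\<lambda>e. chan_o\<questiondown>e \<cdot> Name (Fwd e))
            \<oplus> chan_o\<questiondown>\<bottom> \<cdot> Name (Fwd \<bottom>))) \<in> E"
    using assms unfolding E_def E_T_def by blast
  note unfold = controller_unfold[OF this]
  show ?step ?final unfolding unfold by simp_all
qed

lemma step_Back:
  shows "step E (Name Back) a q \<longleftrightarrow>
      (\<exists>e \<in> with_blank D. a = chan_o\<questiondown>e \<and> q = chan_i\<exclamdown>e \<cdot> Name Back) \<or>
      a = chan_o\<questiondown>Dollar \<and> q = Name (H \<box>)" (is ?step)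
    and "\<not> terminates E (Name Back)" (is ?final)
proof -
  have "(Back, choice (with_blank D) (\<lambda>e. chan_o\<questiondown>e \<cdot> chan_i\<exclamdown>e \<cdot> Name Back)
       \<oplus> chan_o\<questiondown>Dollar \<cdot> Name (H \<box>)) \<in> E"
    unfolding E_def E_T_def by blast
  note unfold = controller_unfold[OF this]
  show ?step ?final unfolding unfold by (auto simp: choice_simps)
qed

text \<open>Merges the two \<open>Fwd\<close> equations, so that one rotation argument also covers
  the moment when the separator \<open>\<bottom>\<close> is the symbol held back.\<close>

lemma step_Fwd:
  assumes "d \<in> insert \<bottom> (with_blank D)"
  shows "step E (Name (Fwd d)) a q \<longleftrightarrow>
      (\<exists>e \<in> with_blank D. a = chan_o\<questiondown>e \<and> q = chan_i\<exclamdown>d \<cdot> Name (Fwd e)) \<or>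
      d \<noteq> \<bottom> \<and> a = chan_o\<questiondown>\<bottom> \<and> q = chan_i\<exclamdown>d \<cdot> Name (Fwd \<bottom>) \<or>
      a = chan_o\<questiondown>Dollar \<and> q = (if d = \<bottom> then chan_i\<exclamdown>\<bottom> \<cdot> Name (H \<box>) else Name (H d))"
      (is ?step)
    and "\<not> terminates E (Name (Fwd d))" (is ?final)
proof -
  have "?step \<and> ?final"
  proof (cases "d = \<bottom>")
    case True
    have "(Fwd \<bottom>, choice (with_blank D) (\<lambda>e. chan_o\<questiondown>e \<cdot> chan_i\<exclamdown>\<bottom> \<cdot> Name (Fwd e))
       \<oplus> chan_o\<questiondown>Dollar \<cdot> chan_i\<exclamdown>\<bottom> \<cdot> Name (H \<box>)) \<in> E"
      unfolding E_def E_T_def by blast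
    from controller_unfold[OF this] show ?thesis using True by (auto simp: choice_simps)
  next
    case False
    have "(Fwd d, choice (with_blank D) (\<lambda>e. chan_o\<questiondown>e \<cdot> chan_i\<exclamdown>d \<cdot> Name (Fwd e))
       \<oplus> chan_o\<questiondown>\<bottom> \<cdot> chan_i\<exclamdown>d \<cdot> Name (Fwd \<bottom>)
       \<oplus> chan_o\<questiondown>Dollar \<cdot> Name (H d)) \<in> E"
      using False assms unfolding E_def E_T_def by blast
    from controller_unfold[OF this] show ?thesis using False by (auto simp: choice_simps)
  qed
  then show ?step ?final by simp_all
qed

text \<open>\<open>Back\<close> takes the last symbol and enters it in front, so the block
  \<open>\<rho>\<close> travels around \<open>\<sigma>\<close> with its order kept. The argument
  runs backwards in time: settling of a later state gives settling of the state before it.\<close>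

lemma Back_rotate:
  assumes "\<rho> \<in> lists (with_blank D)" "\<sigma> \<in> lists (queue_symbols D)"
    and "settles E P (with_queue (Name Back) (\<rho> @ \<sigma>))"
  shows "settles E P (with_queue (Name Back) (\<sigma> @ \<rho>))"
  using assms
\<comment> \<open>Once \<open>e\<close> has gone around, the rest of the block faces
  \<open>e # \<sigma>\<close>, hence the generalisation over \<open>\<sigma>\<close>.\<close>
proof (induction \<rho> arbitrary: \<sigma> rule: rev_induct)
  case Nil
  then show ?case by simp
next
  case (snoc e \<rho>)
  have e: "e \<in> with_blank D" and \<rho>: "\<rho> \<in> lists (queue_symbols D)"
    using snoc.prems(1) lists_mono[OF with_blank_subset] by auto
  have "settles E P (with_queue (Name Back) (e # \<sigma> @ \<rho>))"
    using snoc.IH[of "e # \<sigma>"] snoc.prems e by simp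
  then have "settles E P (with_queue (chan_i\<exclamdown>e \<cdot> Name Back) (\<sigma> @ \<rho>))"
    by (rule send) (use e snoc.prems \<rho> in auto)
  then have "settles E P (with_queue (Name Back) ((\<sigma> @ \<rho>) @ [e]))"
    by (rule receive) (use e snoc.prems \<rho> in \<open>auto simp: step_Back\<close>)
  then show ?case by simp
qed

text \<open>\<open>Fwd x\<close> holds back one symbol, so the word being rotated is \<open>\<rho> @ [x]\<close>. It may contain
  \<open>\<bottom>\<close> only once, as \<open>Fwd \<bottom>\<close> cannot receive \<open>\<bottom>\<close>.\<close>

lemma Fwd_rotate:
  assumes "set (\<rho> @ [x]) \<subseteq> insert \<bottom> (with_blank D)" "count_list (\<rho> @ [x]) \<bottom> \<le> 1"
    and "\<sigma> \<in> lists (queue_symbols D)"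
    and "settles E P (with_queue (Name (Fwd (hd (\<rho> @ [x])))) (tl (\<rho> @ [x]) @ \<sigma>))"
  shows "settles E P (with_queue (Name (Fwd x)) (\<sigma> @ \<rho>))"
  using assms
proof (induction \<rho> arbitrary: \<sigma> x rule: rev_induct)
  case Nil
  then show ?case by simp
next
  case (snoc e \<rho>)
  have x: "x \<in> insert \<bottom> (with_blank D)" and xs: "x \<in> queue_symbols D"
    and e: "e \<in> insert \<bottom> (with_blank D)" and es: "e \<in> queue_symbols D"
    and \<rho>: "\<rho> \<in> lists (queue_symbols D)"
    using snoc.prems(1) by auto
  \<comment> \<open>The count bound rules out that \<open>\<bottom>\<close> is at the output end
    while another one is held.\<close>
  have xe: "e = \<bottom> \<Longrightarrow> x \<noteq> \<bottom>" using snoc.prems(2) by auto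
  \<comment> \<open>After one round \<open>e\<close> is held and \<open>x\<close> has been entered
    in front, so the induction hypothesis concerns the word \<open>\<rho> @ [e]\<close> and the
    queue part \<open>x # \<sigma>\<close>.\<close>
  have "settles E P (with_queue (Name (Fwd e)) ((x # \<sigma>) @ \<rho>))"
  proof (rule snoc.IH)
    show "settles E P (with_queue (Name (Fwd (hd (\<rho> @ [e])))) (tl (\<rho> @ [e]) @ x # \<sigma>))"
      using snoc.prems(4) by (cases \<rho>) simp_all
    show "count_list (\<rho> @ [e]) \<bottom> \<le> 1" using snoc.prems(2) by (simp split: if_splits)
  qed (use snoc.prems xs in auto)
  then have "settles E P (with_queue (Name (Fwd e)) (x # \<sigma> @ \<rho>))"
    by simp
  then have "settles E P (with_queue (chan_i\<exclamdown>x \<cdot> Name (Fwd e)) (\<sigma> @ \<rho>))"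
    by (rule send) (use xs snoc.prems \<rho> in auto)
  then have "settles E P (with_queue (Name (Fwd x)) ((\<sigma> @ \<rho>) @ [e]))"
    by (rule receive) (use e es x xe snoc.prems \<rho> in \<open>auto simp: step_Fwd[OF x]\<close>)
  then show ?case by simp
qed

text \<open>The cell left of the head is the last symbol of \<open>v @ \<bottom> # u\<close>, so
  normally one send and one receive suffice. With \<open>u\<close> empty the separator comes out
  instead; the controller re-enters it right after a \<open>Dollar\<close>, and \<open>Back\<close>
  rotates until the \<open>Dollar\<close> returns.\<close>

lemma settles_HL:
  assumes "d \<in> with_blank D" "u \<in> lists (with_blank D)" "v \<in> lists (with_blank D)"
    and target: "P (if u = [] then with_queue (Name (H \<box>)) (d # v @ [\<bottom>])
      else with_queue (Name (H (last u))) (d # v @ \<bottom> # butlast u))"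
  shows "settles E P (with_queue (Name (HL d)) (v @ \<bottom> # u))"
proof -
  have us: "u \<in> lists (queue_symbols D)" and vs: "v \<in> lists (queue_symbols D)"
    using assms(2,3) lists_mono[OF with_blank_subset] by auto
  let ?p = "choice (with_blank D) (\<lambda>e. chan_o\<questiondown>e \<cdot> Name (H e))
            \<oplus> chan_o\<questiondown>\<bottom> \<cdot> chan_i\<exclamdown>Dollar \<cdot> chan_i\<exclamdown>\<bottom> \<cdot> Name Back"
  have "settles E P (with_queue ?p (d # v @ \<bottom> # u))"
  proof (cases u rule: rev_cases)
    case Nil
    have "settles E P (with_queue (Name (H \<box>)) (d # v @ [\<bottom>]))"
      using target Nil by (auto intro: settled)
    then have "settles E P (with_queue (Name Back) ((d # v @ [\<bottom>]) @ [Dollar]))"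
      by (rule receive) (use assms(1) vs in \<open>auto simp: step_Back\<close>)
    \<comment> \<open>Rotating the block \<open>d # v\<close> brings \<open>Dollar\<close> to the
      output end, with the separator next to it.\<close>
    then have "settles E P (with_queue (Name Back) (\<bottom> # Dollar # d # v))"
      using Back_rotate[of "d # v" "[\<bottom>, Dollar]"] assms by simp
    then have "settles E P (with_queue (chan_i\<exclamdown>\<bottom> \<cdot> Name Back) (Dollar # d # v))"
      by (rule send) (use assms(1) vs in auto)
    then have "settles E P (with_queue (chan_i\<exclamdown>Dollar \<cdot> chan_i\<exclamdown>\<bottom> \<cdot> Name Back) (d # v))"
      by (rule send) (use assms(1) vs in auto)
    then have "settles E P (with_queue ?p ((d # v) @ [\<bottom>]))"
      by (rule receive) (use assms(1) vs in \<open>auto simp: choice_simps\<close>)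
    then show ?thesis using Nil by simp
  next
    case (snoc u' e)
    have e: "e \<in> with_blank D" using assms(2) snoc by simp
    have "settles E P (with_queue (Name (H e)) (d # v @ \<bottom> # u'))"
      using target snoc by (auto intro: settled)
    then have "settles E P (with_queue ?p ((d # v @ \<bottom> # u') @ [e]))"
      by (rule receive) (use assms(1) e us vs snoc in \<open>auto simp: choice_simps\<close>)
    then show ?thesis using snoc by simp
  qed
  then show ?thesis
    by (rule send) (use assms(1) us vs in \<open>auto simp: step_HL\<close>)
qed

text \<open>The cell right of the head is at the input end, reachable only by rotating everything.
  \<open>Dollar\<close> marks the end of the round, and as \<open>Fwd\<close> holds one symbol back,
  the first symbol of \<open>v @ \<bottom> # u\<close> is in hand when \<open>Dollar\<close>
  arrives.\<close>

lemma settles_HR: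
  assumes "d \<in> with_blank D" "u \<in> lists (with_blank D)" "v \<in> lists (with_blank D)"
    and target: "P (if v = [] then with_queue (Name (H \<box>)) (\<bottom> # u @ [d])
      else with_queue (Name (H (hd v))) (tl v @ \<bottom> # u @ [d]))"
  shows "settles E P (with_queue (Name (HR d)) (v @ \<bottom> # u))"
proof -
  have us: "u \<in> lists (queue_symbols D)" and vs: "v \<in> lists (queue_symbols D)"
    using assms(2,3) lists_mono[OF with_blank_subset] by auto
  let ?p = "choice (with_blank D) (\<lambda>e. chan_o\<questiondown>e \<cdot> Name (Fwd e)) \<oplus> chan_o\<questiondown>\<bottom> \<cdot> Name (Fwd \<bottom>)"
  \<comment> \<open>This is the state just before \<open>Dollar\<close> is received. The held symbol
    is the next cell or, for empty \<open>v\<close>, the separator, which must be re-entered before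
    the head stands on a blank.\<close>
  have turned: "settles E P (with_queue (Name (Fwd (hd (v @ \<bottom> # u)))) (tl (v @ \<bottom> # u) @ [d, Dollar]))"
  proof (cases v)
    case Nil
    have "settles E P (with_queue (Name (H \<box>)) (\<bottom> # u @ [d]))"
      using target Nil by (auto intro: settled)
    then have "settles E P (with_queue (chan_i\<exclamdown>\<bottom> \<cdot> Name (H \<box>)) (u @ [d]))"
      by (rule send) (use assms(1) us in auto)
    then have "settles E P (with_queue (Name (Fwd \<bottom>)) ((u @ [d]) @ [Dollar]))"
      by (rule receive) (use assms(1) us in \<open>auto simp: step_Fwd\<close>)
    then show ?thesis using Nil by simp
  next
    case (Cons e v')
    then have e: "e \<in> with_blank D" "e \<noteq> \<bottom>" using assms(3) by auto
    have "settles E P (with_queue (Name (H e)) (v' @ \<bottom> # u @ [d]))"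
      using target Cons by (auto intro: settled)
    then have "settles E P (with_queue (Name (Fwd e)) ((v' @ \<bottom> # u @ [d]) @ [Dollar]))"
      by (rule receive) (use assms(1) us vs e Cons in \<open>auto simp: step_Fwd\<close>)
    then show ?thesis using Cons by simp
  qed
  \<comment> \<open>\<open>x\<close> is the first of these symbols to leave the queue: the last one
    of \<open>u\<close>, or \<open>\<bottom>\<close> when \<open>u\<close> is empty.\<close>
  obtain \<rho> x where \<rho>x: "v @ \<bottom> # u = \<rho> @ [x]"
    by (metis append_is_Nil_conv list.distinct(1) rev_exhaust)
  have sub: "set (\<rho> @ [x]) \<subseteq> insert \<bottom> (with_blank D)"
    unfolding \<rho>x[symmetric] using assms(2,3) by auto
  then have x: "x \<in> insert \<bottom> (with_blank D)"
    and \<rho>: "\<rho> @ [x] \<in> lists (queue_symbols D)"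
    by auto
  have "\<bottom> \<notin> set u" "\<bottom> \<notin> set v" using assms(2,3) by auto
  then have count: "count_list (\<rho> @ [x]) \<bottom> \<le> 1"
    unfolding \<rho>x[symmetric] by simp
  have "settles E P (with_queue (Name (Fwd x)) ([d, Dollar] @ \<rho>))"
    by (rule Fwd_rotate[OF sub count]) (use turned assms(1) in \<open>simp_all add: \<rho>x\<close>)
  then have "settles E P (with_queue ?p (([d, Dollar] @ \<rho>) @ [x]))"
    by (rule receive) (use assms(1) \<rho> x in \<open>auto simp: choice_simps\<close>)
  then have "settles E P (with_queue ?p (d # Dollar # v @ \<bottom> # u))"
    by (simp add: \<rho>x)
  then have "settles E P (with_queue (chan_i\<exclamdown>d \<cdot> ?p) (Dollar # v @ \<bottom> # u))"
    by (rule send) (use assms(1) us vs in auto)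
  then show ?thesis
    by (rule send) (use assms(1) us vs in \<open>auto simp: step_HR\<close>)
qed

end


section \<open>The tape and its representation\<close>

text \<open>Expresses both moves by explicit representatives, with a blank supplied where a tape
  word ends. The same case split governs the targets in \<open>settles_HL\<close> and
  \<open>settles_HR\<close>.\<close>

lemma tape_moves:
  "abs_tape (mark_last u @ Plain d # map Plain v) =
     (if u = [] then tape_at [] \<box> (d # v) else tape_at (butlast u) (last u) (d # v))"
  "abs_tape (map Plain u @ Plain d # mark_first v) =
     (if v = [] then tape_at (u @ [d]) \<box> [] else tape_at (u @ [d]) (hd v) (tl v))"
  by (simp_all add: tape_at_def mark_last_def mark_first_def)

lemma step_tape:
  fixes D :: "'d set"
  assumes "finite D" "d \<in> with_blank D" "u \<in> lists (with_blank D)" "v \<in> lists (with_blank D)"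
  shows "step (E_T_inf D :: ('c, 'd, 'a) tape_spec) (Name (T (tape_at u d v))) a q \<longleftrightarrow>
      a = chan_r\<exclamdown>d \<and> q = Name (T (tape_at u d v)) \<or>
      (\<exists>e \<in> with_blank D. a = chan_w\<questiondown>e \<and> q = Name (T (tape_at u e v))) \<or>
      a = chan_m\<questiondown>MoveLeft \<and>
        q = Name (T (abs_tape (mark_last u @ Plain d # map Plain v))) \<or>
      a = chan_m\<questiondown>MoveRight \<and>
        q = Name (T (abs_tape (map Plain u @ Plain d # mark_first v)))" (is ?step)
    and "terminates (E_T_inf D :: ('c, 'd, 'a) tape_spec) (Name (T (tape_at u d v)))" (is ?final)
proof -
  have "(T (tape_at u d v),
         chan_r\<exclamdown>d \<cdot> Name (T (tape_at u d v))
       \<oplus> choice (with_blank D) (\<lambda>e. chan_w\<questiondown>e \<cdot> Name (T (tape_at u e v)))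
       \<oplus> chan_m\<questiondown>MoveLeft \<cdot> Name (T (abs_tape (mark_last u @ Plain d # map Plain v)))
       \<oplus> chan_m\<questiondown>MoveRight \<cdot> Name (T (abs_tape (map Plain u @ Plain d # mark_first v)))
       \<oplus> \<one>) \<in> (E_T_inf D :: ('c, 'd, 'a) tape_spec)"
    using assms unfolding E_T_inf_def by blast
  from Name_unfold[OF recursive_spec_E_T_inf[OF assms(1)] this] show ?step ?final
    by (simp_all add: step_choice finite_symbols assms(1))
qed

inductive represents ::
    "'d set \<Rightarrow> ('c channel, 'd val, 'a, 'd name) proc \<Rightarrow>
     ('c channel, 'd val, 'a, 'd name) proc \<Rightarrow> bool"
  for D where
  "d \<in> with_blank D \<Longrightarrow> u \<in> lists (with_blank D) \<Longrightarrow> v \<in> lists (with_blank D) \<Longrightarrow>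
   represents D (Name (T (tape_at u d v))) (with_queue (Name (H d)) (v @ \<bottom> # u))"

text \<open>\<open>H d\<close> uses neither \<open>chan_i\<close> nor \<open>chan_o\<close>, and the
  queue uses no other channels, so the queue is frozen and only the actions of \<open>H d\<close>
  remain.\<close>

lemma step_idle:
  fixes D :: "'d set"
  assumes "finite D" "d \<in> with_blank D" "\<sigma> \<in> lists (queue_symbols D)"
  shows "step (controller D :: ('c, 'd, 'a) tape_spec) (with_queue (Name (H d)) \<sigma>) a q \<longleftrightarrow>
      a = chan_r\<exclamdown>d \<and> q = with_queue (Name (H d)) \<sigma> \<or>
      (\<exists>e \<in> with_blank D. a = chan_w\<questiondown>e \<and> q = with_queue (Name (H e)) \<sigma>) \<or>
      a = chan_m\<questiondown>MoveLeft \<and> q = with_queue (Name (HL d)) \<sigma> \<or>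
      a = chan_m\<questiondown>MoveRight \<and> q = with_queue (Name (HR d)) \<sigma>"
  unfolding step_Par_iff step_H[OF assms(1,2)] step_queue[OF assms(1,3)] comm_actions_def
  by auto

text \<open>The queue contents reached in \<open>settles_HL\<close> and \<open>settles_HR\<close>
  are literally those of the representatives in \<open>tape_moves\<close>, without any trimming of
  blanks.\<close>

lemma settles_moves:
  fixes D :: "'d set"
  assumes "finite D" "d \<in> with_blank D" "u \<in> lists (with_blank D)" "v \<in> lists (with_blank D)"
  shows "settles (controller D :: ('c, 'd, 'a) tape_spec)
      (represents D (Name (T (abs_tape (mark_last u @ Plain d # map Plain v)))))
      (with_queue (Name (HL d)) (v @ \<bottom> # u))"
    and "settles (controller D :: ('c, 'd, 'a) tape_spec)
      (represents D (Name (T (abs_tape (map Plain u @ Plain d # mark_first v)))))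
      (with_queue (Name (HR d)) (v @ \<bottom> # u))"
proof -
  show "settles (controller D :: ('c, 'd, 'a) tape_spec)
      (represents D (Name (T (abs_tape (mark_last u @ Plain d # map Plain v)))))
      (with_queue (Name (HL d)) (v @ \<bottom> # u))"
  proof (rule settles_HL[OF assms], cases u rule: rev_cases)
    case Nil
    then show "represents D (Name (T (abs_tape (mark_last u @ Plain d # map Plain v))))
        (if u = [] then with_queue (Name (H \<box>)) (d # v @ [\<bottom>])
         else with_queue (Name (H (last u))) (d # v @ \<bottom> # butlast u))"
      using represents.intros[of \<box> D "[]" "d # v"] assms by (simp add: tape_moves)
  next
    case (snoc u' e)
    then show "represents D (Name (T (abs_tape (mark_last u @ Plain d # map Plain v))))
        (if u = [] then with_queue (Name (H \<box>)) (d # v @ [\<bottom>])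
         else with_queue (Name (H (last u))) (d # v @ \<bottom> # butlast u))"
      using represents.intros[of e D u' "d # v"] assms by (simp add: tape_moves)
  qed
  show "settles (controller D :: ('c, 'd, 'a) tape_spec)
      (represents D (Name (T (abs_tape (map Plain u @ Plain d # mark_first v)))))
      (with_queue (Name (HR d)) (v @ \<bottom> # u))"
  proof (rule settles_HR[OF assms], cases v)
    case Nil
    then show "represents D (Name (T (abs_tape (map Plain u @ Plain d # mark_first v))))
        (if v = [] then with_queue (Name (H \<box>)) (\<bottom> # u @ [d])
         else with_queue (Name (H (hd v))) (tl v @ \<bottom> # u @ [d]))"
      using represents.intros[of \<box> D "u @ [d]" "[]"] assms by (simp add: tape_moves)
  next
    case (Cons e v')
    then show "represents D (Name (T (abs_tape (map Plain u @ Plain d # mark_first v))))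
        (if v = [] then with_queue (Name (H \<box>)) (\<bottom> # u @ [d])
         else with_queue (Name (H (hd v))) (tl v @ \<bottom> # u @ [d]))"
      using represents.intros[of e D "u @ [d]" v'] assms by (simp add: tape_moves)
  qed
qed

theorem theorem4:
  fixes D :: "'d set"
    and d :: "'d val"
    and \<delta>\<^sub>L \<delta>\<^sub>R :: "'d val list"
  assumes "finite D"
    and "d \<in> with_blank D"
    and "\<delta>\<^sub>L \<in> lists (with_blank D)"
    and "\<delta>\<^sub>R \<in> lists (with_blank D)"
  shows "lts_of (E_T_inf D :: ('c, 'd, 'a) tape_spec) (Name (T (tape_at \<delta>\<^sub>L d \<delta>\<^sub>R)))
         \<leftrightarrow>\<^sub>b\<^sup>\<Delta>
         lts_of (E_T D \<union> E_Q_inf D :: ('c, 'd, 'a) tape_spec)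
           [Name (H d) \<parallel> Name (Q (\<delta>\<^sub>R @ [\<bottom>] @ \<delta>\<^sub>L))]({chan_i, chan_o})"
proof (rule db_bisimilar_settles[where S = "represents D"])
  show "represents D (Name (T (tape_at \<delta>\<^sub>L d \<delta>\<^sub>R))) (with_queue (Name (H d)) (\<delta>\<^sub>R @ [\<bottom>] @ \<delta>\<^sub>L))"
    using represents.intros[OF assms(2-4)] by simp
next
  fix p q :: "('c channel, 'd val, 'a, 'd name) proc"
  assume "represents D p q"
  then obtain u d v where
    pq: "p = Name (T (tape_at u d v))" "q = with_queue (Name (H d)) (v @ \<bottom> # u)"
    and in_D: "d \<in> with_blank D" "u \<in> lists (with_blank D)" "v \<in> lists (with_blank D)"
    by cases
  have queue: "v @ \<bottom> # u \<in> lists (queue_symbols D)"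
    using in_D lists_mono[OF with_blank_subset] by auto
  note step_p = step_tape[OF assms(1) in_D, where ?'c = 'c and ?'a = 'a]
  note step_q = step_idle[OF assms(1) in_D(1) queue, where ?'c = 'c and ?'a = 'a]
  \<comment> \<open>After a read or a write the right side is idle at once, so the settling path is
    empty.\<close>
  have match: "settles (controller D :: ('c, 'd, 'a) tape_spec)
      (represents D (Name (T (tape_at u e v)))) (with_queue (Name (H e)) (v @ \<bottom> # u))"
    if "e \<in> with_blank D" for e
    using represents.intros[OF that in_D(2,3)] by (rule settled)
  note targets = match settles_moves[OF assms(1) in_D]
  \<comment> \<open>Both sides have the same four kinds of transitions, so the facts in
    \<open>targets\<close> serve both directions.\<close>
  show "\<exists>q'. step (controller D) q a q' \<and> settles (controller D) (represents D p') q'"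
    if "step (E_T_inf D) p a p'" for a p'
    using that targets in_D(1) unfolding pq step_p step_q by blast
  show "\<exists>p'. step (E_T_inf D) p a p' \<and> settles (controller D) (represents D p') q'"
    if "step (controller D) q a q'" for a q'
    using that targets in_D(1) unfolding pq step_p step_q by blast
  show "terminates (E_T_inf D) p \<longleftrightarrow> terminates (controller D) q"
    using step_p(2) step_H(2)[OF assms(1) in_D(1)] step_queue(2)[OF assms(1) queue]
    by (simp add: pq)
  show "\<not> step (E_T_inf D) p \<tau> p'" for p'
    unfolding pq step_p by simp
qed

end
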